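(* Let $G$ be a finite simple graph on the vertices $1,\dots,n$, let $k$ be a field, and let $I_G\subseteq k[x_1,\dots,x_n]$ be the edge ideal of $G$. Let $i$ be a vertex of $G$. Then there exists a polarization $\widetilde{I_G}$ of $I_G$ in which the variable $x_i$ is polarized into $x_i$ and $x_{i'}$ if and only if the graph $G|_{\mathrm{link}(i)}$, i.e. $G$ restricted to the vertices which are neighbours of $i$, contains a complete bipartite graph on all its vertices. Moreover, every choice of such a bipartitioning $A\cup B$ of the set of neighbours of $i$ corresponds to a polarization: let $i$ be neighbour to the vertices of one part and $i'$ be neighbour to the vertices of the other part, and obtain $\widetilde{I_G}$ from $I_G$ by choosing $x_i$ in the monomials $x_ix_a$ corresponding to one part and $x_{i'}$ in those corresponding to the other part.
   Context: Edge ideal: $I_G=(x_ix_j : (i,j)\text{ is an edge of }G)$. Polarization (one variable split in two): an ideal $\widetilde{I_G}$ in $\widetilde S=k[x_1,\dots,x_n,x_{i'}]$ is a polarization of $I_G$ in which $x_i$ is polarized into $x_i$ and $x_{i'}$ if it is a square-free monomial ideal, $x_i-x_{i'}$ is a non-zero divisor on $\widetilde S/\widetilde{I_G}$, and substituting $x_{i'}\mapsto x_i$ carries $\widetilde{I_G}$ to $I_G$ (i.e. $\widetilde{I_G}\otimes\widetilde S/(x_i-x_{i'})\cong I_G$); both $x_i$ and $x_{i'}$ are required to occur in the generators of $\widetilde{I_G}$. "Contains a complete bipartite graph on all its vertices" means: the vertex set of $G|_{\mathrm{link}(i)}$ can be written as a disjoint union $A\cup B$ with $A,B$ nonempty, such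 that every $a\in A$ is adjacent in $G$ to every $b\in B$ (there may be further edges). *)

theory Defs
  imports Complex_Main "HOL-Library.Poly_Mapping"
begin

text \<open>
  A monomial with variables indexed by \<open>'v\<close> is its exponent vector \<open>'v \<Rightarrow>\<^sub>0 nat\<close>, and
  \<open>('v, 'k) mpoly\<close> is the polynomial ring over \<open>'k\<close> in these variables; the ring structure is the
  convolution product of the library.
\<close>

type_synonym ('v, 'k) mpoly = "('v \<Rightarrow>\<^sub>0 nat) \<Rightarrow>\<^sub>0 'k"

definition monomial :: "('v \<Rightarrow>\<^sub>0 nat) \<Rightarrow> ('v, 'k::field) mpoly" where
  "monomial m = Poly_Mapping.single m 1"

definition coefficient :: "'k \<Rightarrow> ('v, 'k::field) mpoly" where
  "coefficient c = Poly_Mapping.single 0 c"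

definition var :: "'v \<Rightarrow> ('v, 'k::field) mpoly" where
  "var v = monomial (Poly_Mapping.single v 1)"

definition subst_vars :: "('v \<Rightarrow> ('w, 'k) mpoly) \<Rightarrow> ('v, 'k::field) mpoly \<Rightarrow> ('w, 'k) mpoly" where
  "subst_vars \<sigma> p =
     (\<Sum>m\<in>Poly_Mapping.keys p.
        coefficient (Poly_Mapping.lookup p m) *
        (\<Prod>v\<in>Poly_Mapping.keys m. \<sigma> v ^ Poly_Mapping.lookup m v))"

text \<open>
  The ideals of a commutative ring are its submodules as a module over itself, so
  \<open>ideal.subspace I\<close> says that \<open>I\<close> is an ideal and \<open>ideal.span B\<close> is the ideal generated by \<open>B\<close>.
\<close>

global_interpretation ideal: module "(*) :: 'a::comm_ring_1 \<Rightarrow> 'a \<Rightarrow> 'a"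
  by unfold_locales (simp_all add: algebra_simps)

definition squarefree_monomial :: "('v \<Rightarrow>\<^sub>0 nat) \<Rightarrow> bool" where
  "squarefree_monomial m \<longleftrightarrow> (\<forall>v. Poly_Mapping.lookup m v \<le> 1)"

definition squarefree_monomial_ideal :: "('v, 'k::field) mpoly set \<Rightarrow> bool" where
  "squarefree_monomial_ideal I \<longleftrightarrow>
     (\<exists>M. (\<forall>m\<in>M. squarefree_monomial m) \<and> I = ideal.span (monomial ` M))"

text \<open>
  The unique minimal monomial generating set of a monomial ideal: the monomials of the ideal that
  are minimal with respect to divisibility.
\<close>

definition min_gens :: "('v, 'k::field) mpoly set \<Rightarrow> ('v \<Rightarrow>\<^sub>0 nat) set" where
  "min_gens I =
     {m. monomial m \<in> I \<and>
         (\<forall>m'. monomial m' \<in> I \<and>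
               (\<forall>v. Poly_Mapping.lookup m' v \<le> Poly_Mapping.lookup m v) \<longrightarrow> m' = m)}"

definition occurs_in_gens :: "'v \<Rightarrow> ('v, 'k::field) mpoly set \<Rightarrow> bool" where
  "occurs_in_gens v I \<longleftrightarrow> (\<exists>m\<in>min_gens I. v \<in> Poly_Mapping.keys m)"

text \<open>
  \<open>f\<close> is a non-zero divisor on the quotient by \<open>I\<close>: the class of \<open>f * g\<close> vanishes only if the class
  of \<open>g\<close> does.
\<close>

definition nonzerodivisor_mod :: "'a::comm_ring_1 \<Rightarrow> 'a set \<Rightarrow> bool" where
  "nonzerodivisor_mod f I \<longleftrightarrow> (\<forall>g. f * g \<in> I \<longrightarrow> g \<in> I)"

text \<open>
  A finite simple graph is given by its adjacency relation \<open>E\<close>, symmetric and irreflexive, on a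
  finite vertex type.
\<close>

definition link :: "('v \<Rightarrow> 'v \<Rightarrow> bool) \<Rightarrow> 'v \<Rightarrow> 'v set" where
  "link E i = {j. E i j}"

text \<open>
  The restriction of \<open>E\<close> to \<open>W\<close> contains the complete bipartite graph with parts \<open>A\<close> and \<open>B\<close> on all
  its vertices. Edges inside \<open>A\<close> or \<open>B\<close> are allowed.
\<close>

definition complete_bipartition ::
  "('v \<Rightarrow> 'v \<Rightarrow> bool) \<Rightarrow> 'v set \<Rightarrow> 'v set \<Rightarrow> 'v set \<Rightarrow> bool" where
  "complete_bipartition E W A B \<longleftrightarrow>
     A \<union> B = W \<and> A \<inter> B = {} \<and> A \<noteq> {} \<and> B \<noteq> {} \<and> (\<forall>a\<in>A. \<forall>b\<in>B. E a b)"

definition edge_ideal :: "('v \<Rightarrow> 'v \<Rightarrow> bool) \<Rightarrow> ('v, 'k::field) mpoly set" where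
  "edge_ideal E = ideal.span {var a * var b |a b. E a b}"

text \<open>
  In the ring with one additional variable, \<open>Some j\<close> is the old variable \<open>x\<^sub>j\<close> and \<open>None\<close> is the new
  variable \<open>x\<^sub>i\<^sub>'\<close>. The following is the substitution of \<open>x\<^sub>i\<close> for \<open>x\<^sub>i\<^sub>'\<close>.
\<close>

definition depolarize :: "'v \<Rightarrow> ('v option, 'k::field) mpoly \<Rightarrow> ('v, 'k) mpoly" where
  "depolarize i = subst_vars (\<lambda>w. case w of None \<Rightarrow> var i | Some j \<Rightarrow> var j)"

definition is_polarization ::
  "('v \<Rightarrow> 'v \<Rightarrow> bool) \<Rightarrow> 'v \<Rightarrow> ('v option, 'k::field) mpoly set \<Rightarrow> bool" where
  "is_polarization E i J \<longleftrightarrow>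
     squarefree_monomial_ideal J \<and>
     nonzerodivisor_mod (var (Some i) - var None) J \<and>
     depolarize i ` J = edge_ideal E \<and>
     occurs_in_gens (Some i) J \<and> occurs_in_gens None J"

definition bipartition_ideal ::
  "('v \<Rightarrow> 'v \<Rightarrow> bool) \<Rightarrow> 'v \<Rightarrow> 'v set \<Rightarrow> 'v set \<Rightarrow> ('v option, 'k::field) mpoly set" where
  "bipartition_ideal E i A B =
     ideal.span
       ({var (Some a) * var (Some b) |a b. E a b \<and> a \<noteq> i \<and> b \<noteq> i} \<union>
        {var (Some i) * var (Some a) |a. a \<in> A} \<union>
        {var None * var (Some b) |b. b \<in> B})"

end

theory Submission imports Defs begin

text \<open>
  A difference of variables \<open>x - y\<close> is a non-zero divisor modulo a square-free monomial ideal \<open>J\<close>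
  iff every monomial \<open>m\<close> with \<open>x m \<in> J\<close> and \<open>y m \<in> J\<close> already lies in \<open>J\<close>. Let \<open>A\<close> and \<open>B\<close> be
  the sets of neighbours \<open>a\<close> of \<open>i\<close> such that \<open>x\<^sub>i x\<^sub>a \<in> J\<close>, respectively \<open>x\<^sub>i\<^sub>' x\<^sub>a \<in> J\<close>. Since \<open>J\<close>
  maps onto the edge ideal, they cover the link. The criterion applied to \<open>x\<^sub>a\<close> shows that they are
  disjoint, and applied to \<open>x\<^sub>a x\<^sub>b\<close> with \<open>a \<in> A\<close>, \<open>b \<in> B\<close> that \<open>a\<close> and \<open>b\<close> are adjacent.
  Conversely, the ideal of a bipartition is the edge ideal of the graph in which \<open>i\<close> is split into two
  vertices, and the criterion is immediate from the completeness of the bipartition.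
\<close>

section \<open>Monomial ideals\<close>

lemma sum_single_lookup: "(\<Sum>k\<in>Poly_Mapping.keys p. Poly_Mapping.single k (Poly_Mapping.lookup p k)) = p"
proof (rule poly_mapping_eqI)
  fix k
  have "Poly_Mapping.lookup (\<Sum>k\<in>Poly_Mapping.keys p. Poly_Mapping.single k (Poly_Mapping.lookup p k)) k =
      (\<Sum>j\<in>Poly_Mapping.keys p. if k = j then Poly_Mapping.lookup p k else 0)"
    by (auto simp: lookup_sum lookup_single when_def intro!: sum.cong)
  then show "Poly_Mapping.lookup (\<Sum>k\<in>Poly_Mapping.keys p. Poly_Mapping.single k (Poly_Mapping.lookup p k)) k =
      Poly_Mapping.lookup p k"
    by (simp add: in_keys_iff)
qed

lemma keys_add_nat: "Poly_Mapping.keys (m + n) = Poly_Mapping.keys m \<union> Poly_Mapping.keys n"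
  for m n :: "'a \<Rightarrow>\<^sub>0 nat"
  by (auto simp: in_keys_iff lookup_add)

text \<open>Subtraction of exponents is truncated; the pointwise comparison makes
  \<open>n - m\<close> a true quotient of monomials.\<close>

lemma divisor_of_lookup_le:
  fixes m n :: "'a \<Rightarrow>\<^sub>0 nat"
  assumes "\<And>v. Poly_Mapping.lookup m v \<le> Poly_Mapping.lookup n v"
  shows "n = (n - m) + m"
  by (rule poly_mapping_eqI) (simp add: lookup_add lookup_minus assms)

lemma single_plus_minus:
  fixes m :: "'a \<Rightarrow>\<^sub>0 nat"
  assumes "v \<in> Poly_Mapping.keys m"
  shows "m = Poly_Mapping.single v 1 + (m - Poly_Mapping.single v 1)"
proof (rule poly_mapping_eqI)
  fix w
  have "Poly_Mapping.lookup m v \<ge> 1"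
    using assms by (simp add: in_keys_iff)
  then show "Poly_Mapping.lookup m w =
      Poly_Mapping.lookup (Poly_Mapping.single v 1 + (m - Poly_Mapping.single v 1)) w"
    by (auto simp: lookup_add lookup_minus lookup_single when_def)
qed

lemma two_keys_split:
  fixes m :: "'a \<Rightarrow>\<^sub>0 nat"
  assumes "u \<in> Poly_Mapping.keys m" "v \<in> Poly_Mapping.keys m" "u \<noteq> v"
  obtains n where "m = n + (Poly_Mapping.single u 1 + Poly_Mapping.single v 1)"
proof
  show "m = (m - (Poly_Mapping.single u 1 + Poly_Mapping.single v 1)) +
      (Poly_Mapping.single u 1 + Poly_Mapping.single v 1)"
    using assms
    by (intro divisor_of_lookup_le)
       (auto simp: lookup_add lookup_single when_def in_keys_iff Suc_le_eq)
qed

lemma monomial_mult: "monomial m * monomial n = monomial (m + n)"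
  by (simp add: monomial_def mult_single)

lemma keys_monomial: "Poly_Mapping.keys (monomial m :: ('v, 'k::field) mpoly) = {m}"
  by (simp add: monomial_def)

lemma monomial_add_in_span:
  "monomial m \<in> ideal.span S \<Longrightarrow> monomial (n + m) \<in> ideal.span S"
  by (metis ideal.span_scale monomial_mult)

text \<open>The polynomials whose terms are all divisible by generators form an ideal; conversely
  such a polynomial is the sum of its terms, each a multiple of a generator.\<close>

lemma in_monomial_ideal_iff:
  fixes p :: "('v, 'k::field) mpoly"
  shows "p \<in> ideal.span (monomial ` M) \<longleftrightarrow> (\<forall>m\<in>Poly_Mapping.keys p. \<exists>g\<in>M. \<exists>n. m = n + g)"
proof
  assume "p \<in> ideal.span (monomial ` M)"
  then show "\<forall>m\<in>Poly_Mapping.keys p. \<exists>g\<in>M. \<exists>n. m = n + g"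
  proof (induction rule: ideal.span_induct_alt)
    case base
    then show ?case by simp
  next
    case (step c q p)
    then obtain g where g: "g \<in> M" "q = monomial g" by auto
    show ?case
    proof
      fix m assume "m \<in> Poly_Mapping.keys (c * q + p)"
      then consider "m \<in> Poly_Mapping.keys (c * q)" | "m \<in> Poly_Mapping.keys p"
        using keys_add[of "c * q" p] by blast
      then show "\<exists>g\<in>M. \<exists>n. m = n + g"
      proof cases
        case 1
        then obtain a where "m = a + g"
          using keys_mult[of c q] unfolding g(2) keys_monomial by blast
        then show ?thesis using g(1) by blast
      qed (use step in auto)
    qed
  qed
next
  assume *: "\<forall>m\<in>Poly_Mapping.keys p. \<exists>g\<in>M. \<exists>n. m = n + g"
  have "(\<Sum>m\<in>Poly_Mapping.keys p. Poly_Mapping.single m (Poly_Mapping.lookup p m))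
      \<in> ideal.span (monomial ` M)"
  proof (rule ideal.span_sum)
    fix m assume "m \<in> Poly_Mapping.keys p"
    then obtain g n where g: "g \<in> M" "m = n + g" using * by blast
    have "Poly_Mapping.single m (Poly_Mapping.lookup p m) =
        Poly_Mapping.single n (Poly_Mapping.lookup p m) * monomial g"
      by (simp add: monomial_def mult_single g)
    then show "Poly_Mapping.single m (Poly_Mapping.lookup p m) \<in> ideal.span (monomial ` M)"
      using g by (auto intro: ideal.span_scale ideal.span_base)
  qed
  then show "p \<in> ideal.span (monomial ` M)"
    by (simp add: sum_single_lookup)
qed

lemma in_monomial_ideal_iff_monomials:
  fixes p :: "('v, 'k::field) mpoly"
  shows "p \<in> ideal.span (monomial ` M) \<longleftrightarrow>
    (\<forall>m\<in>Poly_Mapping.keys p. (monomial m :: ('v, 'k) mpoly) \<in> ideal.span (monomial ` M))"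
  by (simp add: in_monomial_ideal_iff keys_monomial)

section \<open>Differences of variables as non-zero divisors\<close>

lemma lookup_monomial_mult:
  "Poly_Mapping.lookup (monomial k * p) (k + m) = Poly_Mapping.lookup (p :: ('v, 'k::field) mpoly) m"
  by (simp add: monomial_def lookup_mult lookup_single when_mult)

lemma lookup_monomial_mult_eq_0:
  assumes "\<And>m. m \<in> Poly_Mapping.keys p \<Longrightarrow> l \<noteq> k + m"
  shows "Poly_Mapping.lookup (monomial k * (p :: ('v, 'k::field) mpoly)) l = 0"
proof -
  have "l \<notin> Poly_Mapping.keys (monomial k * p)"
    using keys_mult[of "monomial k" p] assms by (auto simp: keys_monomial)
  then show ?thesis by (simp add: in_keys_iff)
qed

text \<open>
  Of the monomials of \<open>g\<close> outside the ideal take one with the largest exponent of \<open>x\<close>: its product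
  with \<open>x\<close> cannot be cancelled by a monomial of \<open>y g\<close> outside the ideal. Square-freeness then forces
  that largest exponent to be \<open>0\<close>, so that every monomial of \<open>g\<close> outside the ideal was maximal.
\<close>

lemma mult_var_in_of_diff_mult_in:
  fixes g :: "('v, 'k::field) mpoly"
  assumes sqf: "\<And>m. m \<in> M \<Longrightarrow> squarefree_monomial m"
    and J: "J = ideal.span (monomial ` M)"
    and "x \<noteq> y"
    and xyg: "(var x - var y) * g \<in> J"
    and m: "m \<in> Poly_Mapping.keys g" "(monomial m :: ('v, 'k) mpoly) \<notin> J"
  shows "(monomial (Poly_Mapping.single x 1 + m) :: ('v, 'k) mpoly) \<in> J"
proof -
  let ?in = "\<lambda>m. (monomial m :: ('v, 'k) mpoly) \<in> J"
  let ?x = "Poly_Mapping.single x (1::nat)" and ?y = "Poly_Mapping.single y (1::nat)"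
  define N where "N = {m \<in> Poly_Mapping.keys g. \<not> ?in m}"
  have in_max: "?in (?x + n)"
    if n: "n \<in> N" "\<And>n'. n' \<in> N \<Longrightarrow> Poly_Mapping.lookup n' x \<le> Poly_Mapping.lookup n x" for n
  proof (cases "\<exists>n'\<in>Poly_Mapping.keys g. ?x + n = ?y + n'")
    case True
    then obtain n' where n': "n' \<in> Poly_Mapping.keys g" "?x + n = ?y + n'" by blast
    \<comment> \<open>Here the exponent of \<open>x\<close> in \<open>n'\<close> exceeds the maximum
      over \<open>N\<close>, so \<open>n'\<close> is a monomial of the ideal.\<close>
    have "Poly_Mapping.lookup (?x + n) x = Poly_Mapping.lookup (?y + n') x" by (simp only: n'(2))
    then have "Poly_Mapping.lookup n' x = Suc (Poly_Mapping.lookup n x)"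
      using \<open>x \<noteq> y\<close> by (simp add: lookup_add lookup_single)
    then have "?in n'"
      using n(2)[of n'] n'(1) by (auto simp: N_def)
    then show ?thesis
      unfolding n'(2) J by (rule monomial_add_in_span)
  next
    case False
    have "Poly_Mapping.lookup ((var x - var y) * g) (?x + n) = Poly_Mapping.lookup g n"
      using False
      by (simp add: left_diff_distrib lookup_minus var_def lookup_monomial_mult
          lookup_monomial_mult_eq_0)
    then have "?x + n \<in> Poly_Mapping.keys ((var x - var y) * g)"
      using n(1) by (simp add: N_def in_keys_iff)
    then show ?thesis
      using xyg unfolding J by (subst (asm) in_monomial_ideal_iff_monomials) blast
  qed
  have "finite N" "m \<in> N"
    using m by (auto simp: N_def)
  define d where "d = Max ((\<lambda>n. Poly_Mapping.lookup n x) ` N)"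
  have le_d: "Poly_Mapping.lookup n x \<le> d" if "n \<in> N" for n
    using that \<open>finite N\<close> by (simp add: d_def)
  have "d \<in> (\<lambda>n. Poly_Mapping.lookup n x) ` N"
    unfolding d_def using \<open>finite N\<close> \<open>m \<in> N\<close> by (intro Max_in) auto
  then obtain n where n: "n \<in> N" "Poly_Mapping.lookup n x = d" by blast
  then have "?in (?x + n)"
    using in_max le_d by blast
  then obtain h l where h: "h \<in> M" "?x + n = l + h"
    unfolding J in_monomial_ideal_iff by (auto simp: keys_monomial)
  have "d = 0"
  proof (rule ccontr)
    assume "d \<noteq> 0"
    \<comment> \<open>The generator \<open>h\<close> divides the product of \<open>x\<close> and
      \<open>n\<close>. Its exponent of \<open>x\<close> is at most 1, hence at most the positive
      exponent \<open>d\<close>, so \<open>h\<close> already divides \<open>n\<close>.\<close>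
    have "Poly_Mapping.lookup h v \<le> Poly_Mapping.lookup n v" for v
    proof (cases "v = x")
      case True
      then show ?thesis
        using sqf[OF h(1)] \<open>d \<noteq> 0\<close> n(2) unfolding squarefree_monomial_def
        by (metis One_nat_def Suc_leI le_trans not_gr_zero)
    next
      case False
      have "Poly_Mapping.lookup (?x + n) v = Poly_Mapping.lookup (l + h) v" by (simp only: h(2))
      then show ?thesis
        using False by (simp add: lookup_add lookup_single)
    qed
    then have "n = (n - h) + h" by (rule divisor_of_lookup_le)
    then have "?in n"
      using h(1) unfolding J in_monomial_ideal_iff by (auto simp: keys_monomial)
    then show False
      using n(1) by (simp add: N_def)
  qed
  then show ?thesis
    using le_d \<open>m \<in> N\<close> by (intro in_max) (simp_all add: le_d)
qed

text \<open>One direction multiplies \<open>var x - var y\<close> by \<open>m\<close>. For the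
  other, the preceding lemma is used for \<open>x - y\<close> and, after a change of sign, for
  \<open>y - x\<close>: a monomial of \<open>g\<close> outside \<open>J\<close> has both its
  products with \<open>x\<close> and \<open>y\<close> in \<open>J\<close>, against the
  criterion.\<close>

lemma nonzerodivisor_mod_var_diff_iff:
  fixes J :: "('v, 'k::field) mpoly set"
  assumes "squarefree_monomial_ideal J" "x \<noteq> y"
  shows "nonzerodivisor_mod (var x - var y) J \<longleftrightarrow>
    (\<forall>m. (monomial (Poly_Mapping.single x 1 + m) :: ('v, 'k) mpoly) \<in> J \<and>
         (monomial (Poly_Mapping.single y 1 + m) :: ('v, 'k) mpoly) \<in> J \<longrightarrow>
         (monomial m :: ('v, 'k) mpoly) \<in> J)"
    (is "_ \<longleftrightarrow> ?R")
proof -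
  obtain M where M: "\<And>m. m \<in> M \<Longrightarrow> squarefree_monomial m" "J = ideal.span (monomial ` M)"
    using assms(1) by (auto simp: squarefree_monomial_ideal_def)
  show ?thesis
  proof
    assume nzd: "nonzerodivisor_mod (var x - var y) J"
    show ?R
    proof (intro allI impI)
      fix m
      assume "(monomial (Poly_Mapping.single x 1 + m) :: ('v, 'k) mpoly) \<in> J \<and>
         (monomial (Poly_Mapping.single y 1 + m) :: ('v, 'k) mpoly) \<in> J"
      then have "(var x - var y) * monomial m \<in> J"
        unfolding M(2) left_diff_distrib var_def monomial_mult
        by (intro ideal.span_diff) auto
      then show "(monomial m :: ('v, 'k) mpoly) \<in> J"
        using nzd by (simp add: nonzerodivisor_mod_def)
    qed
  next
    assume R: ?R
    show "nonzerodivisor_mod (var x - var y) J"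
      unfolding nonzerodivisor_mod_def
    proof (intro allI impI)
      fix g :: "('v, 'k) mpoly"
      assume xy: "(var x - var y) * g \<in> J"
      then have "- ((var x - var y) * g) \<in> J"
        unfolding M(2) by (rule ideal.span_neg)
      then have yx: "(var y - var x) * g \<in> J"
        by (simp add: left_diff_distrib)
      show "g \<in> J"
        unfolding M(2)
      proof (subst in_monomial_ideal_iff_monomials, rule ballI)
        fix m assume "m \<in> Poly_Mapping.keys g"
        then show "(monomial m :: ('v, 'k) mpoly) \<in> ideal.span (monomial ` M)"
          using mult_var_in_of_diff_mult_in[OF M assms(2) xy, of m]
            mult_var_in_of_diff_mult_in[OF M assms(2)[symmetric] yx, of m] R M(2) by blast
      qed
    qed
  qed
qed

section \<open>Relabelling\<close>

text \<open>
  Applied to an exponent vector this renames variables, merging those with the same new name;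
  applied to a polynomial it maps each monomial.
\<close>

definition push_forward :: "('a \<Rightarrow> 'b) \<Rightarrow> ('a \<Rightarrow>\<^sub>0 'c) \<Rightarrow> 'b \<Rightarrow>\<^sub>0 'c::comm_monoid_add" where
  "push_forward f p = (\<Sum>w\<in>Poly_Mapping.keys p. Poly_Mapping.single (f w) (Poly_Mapping.lookup p w))"

lemma push_forward_zero [simp]: "push_forward f 0 = 0"
  by (simp add: push_forward_def)

lemma push_forward_single [simp]:
  "push_forward f (Poly_Mapping.single w c) = Poly_Mapping.single (f w) c"
  by (simp add: push_forward_def)

lemma push_forward_add: "push_forward f (p + q) = push_forward f p + push_forward f q"
  unfolding push_forward_def
  by (rule setsum_keys_plus_distrib) (simp_all add: single_add)

lemma push_forward_sum: "push_forward f (\<Sum>x\<in>X. p x) = (\<Sum>x\<in>X. push_forward f (p x))"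
  by (induction X rule: infinite_finite_induct) (simp_all add: push_forward_add)

lemma push_forward_push_forward: "push_forward g (push_forward f p) = push_forward (\<lambda>w. g (f w)) p"
  by (simp add: push_forward_def[of f] push_forward_sum) (simp add: push_forward_def)

lemma push_forward_ident:
  "(\<And>w. w \<in> Poly_Mapping.keys p \<Longrightarrow> f w = w) \<Longrightarrow> push_forward f p = p"
  by (simp add: push_forward_def sum_single_lookup)

lemma keys_push_forward_subset: "Poly_Mapping.keys (push_forward f p) \<subseteq> f ` Poly_Mapping.keys p"
proof
  fix k assume "k \<in> Poly_Mapping.keys (push_forward f p)"
  then have "(\<Sum>w\<in>Poly_Mapping.keys p. Poly_Mapping.lookup (Poly_Mapping.single (f w) (Poly_Mapping.lookup p w)) k) \<noteq> 0"
    by (simp add: in_keys_iff push_forward_def lookup_sum)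
  then obtain w where "w \<in> Poly_Mapping.keys p"
      "Poly_Mapping.lookup (Poly_Mapping.single (f w) (Poly_Mapping.lookup p w)) k \<noteq> 0"
    by (meson sum.neutral)
  then show "k \<in> f ` Poly_Mapping.keys p"
    by (auto simp: lookup_single when_def split: if_splits)
qed

text \<open>Natural exponents cannot cancel when variables are merged, so the previous inclusion
  becomes an equality.\<close>

lemma keys_push_forward_nat: "Poly_Mapping.keys (push_forward f m) = f ` Poly_Mapping.keys m"
  for m :: "'a \<Rightarrow>\<^sub>0 nat"
  by (auto simp: in_keys_iff push_forward_def lookup_sum lookup_single when_def image_iff Bex_def
      split: if_splits)

text \<open>Variables \<open>u\<close>, \<open>v\<close> of \<open>m\<close> over \<open>a\<close>,
  \<open>b\<close> are distinct, so their product divides \<open>m\<close>; the cofactor is sent to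
  0 and hence is trivial.\<close>

lemma push_forward_eq_two_singles:
  fixes m :: "'a \<Rightarrow>\<^sub>0 nat"
  assumes "push_forward f m = Poly_Mapping.single a 1 + Poly_Mapping.single b 1" "a \<noteq> b"
  obtains u v where "m = Poly_Mapping.single u 1 + Poly_Mapping.single v 1" "f u = a" "f v = b"
proof -
  have "f ` Poly_Mapping.keys m = {a, b}"
    unfolding keys_push_forward_nat[symmetric] assms(1) by (auto simp: keys_add_nat)
  then obtain u v where uv: "u \<in> Poly_Mapping.keys m" "v \<in> Poly_Mapping.keys m" "f u = a" "f v = b"
    by (metis imageE insertI1 insertI2)
  then obtain n where n: "m = n + (Poly_Mapping.single u 1 + Poly_Mapping.single v 1)"
    using two_keys_split assms(2) by metis
  have "push_forward f n = 0"
    using assms(1) uv unfolding n by (simp add: push_forward_add)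
  then have "Poly_Mapping.keys n = {}"
    using keys_push_forward_nat[of f n] by simp
  then have "n = 0"
    by (metis sum_single_lookup sum.empty)
  then show thesis
    using that n uv by simp
qed

section \<open>Substitution of variables as relabelling\<close>

lemma var_power: "var v ^ n = monomial (Poly_Mapping.single v n)"
  by (induction n)
     (simp_all add: var_def monomial_mult single_add[symmetric], simp add: monomial_def)

lemma prod_monomial: "(\<Prod>x\<in>X. monomial (m x)) = monomial (\<Sum>x\<in>X. m x)"
  by (induction X rule: infinite_finite_induct)
     (simp_all add: monomial_mult, simp_all add: monomial_def)

text \<open>The inner \<open>push_forward\<close> renames variables inside an exponent vector, the
  outer one carries each term of the polynomial to its renamed monomial.\<close>

lemma subst_vars_var:
  "subst_vars (\<lambda>v. var (f v)) p = push_forward (push_forward f) p"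
  unfolding subst_vars_def push_forward_def[of "push_forward f"]
  by (rule sum.cong)
     (simp_all add: var_power prod_monomial,
      simp add: push_forward_def coefficient_def monomial_def mult_single)

lemma depolarize_eq_push_forward: "depolarize i = push_forward (push_forward (case_option i id))"
proof -
  have "(\<lambda>w. case w of None \<Rightarrow> var i | Some j \<Rightarrow> var j) = (\<lambda>w. var (case_option i id w))"
    by (auto split: option.split)
  then show ?thesis
    unfolding depolarize_def by (rule ssubst) (rule ext, rule subst_vars_var)
qed

section \<open>Edge ideals\<close>

lemma edge_ideal_eq:
  "edge_ideal E =
    ideal.span (monomial ` {Poly_Mapping.single a 1 + Poly_Mapping.single b 1 |a b. E a b})"
  unfolding edge_ideal_def var_def monomial_mult
  by (rule arg_cong[where f = ideal.span]) auto

text \<open>In the absence of loops the ends of an edge are distinct, so their product divides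
  \<open>m\<close> as soon as both occur in it. Membership thus depends only on the supports of the
  monomials.\<close>

lemma in_edge_ideal_iff:
  fixes p :: "('v, 'k::field) mpoly"
  assumes "irreflp E"
  shows "p \<in> edge_ideal E \<longleftrightarrow>
    (\<forall>m\<in>Poly_Mapping.keys p. \<exists>a\<in>Poly_Mapping.keys m. \<exists>b\<in>Poly_Mapping.keys m. E a b)"
  unfolding edge_ideal_eq in_monomial_ideal_iff
proof (rule ball_cong[OF refl])
  fix m :: "'v \<Rightarrow>\<^sub>0 nat"
  show "(\<exists>g\<in>{Poly_Mapping.single a 1 + Poly_Mapping.single b 1 |a b. E a b}. \<exists>n. m = n + g) \<longleftrightarrow>
      (\<exists>a\<in>Poly_Mapping.keys m. \<exists>b\<in>Poly_Mapping.keys m. E a b)"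
  proof
    assume "\<exists>a\<in>Poly_Mapping.keys m. \<exists>b\<in>Poly_Mapping.keys m. E a b"
    then obtain a b where ab: "a \<in> Poly_Mapping.keys m" "b \<in> Poly_Mapping.keys m" "E a b" by blast
    then have "a \<noteq> b" using assms by (auto simp: irreflp_def)
    with ab show "\<exists>g\<in>{Poly_Mapping.single a 1 + Poly_Mapping.single b 1 |a b. E a b}. \<exists>n. m = n + g"
      using two_keys_split[of a m b] by blast
  qed (auto simp: keys_add_nat)
qed

lemma monomial_in_edge_ideal_iff:
  assumes "irreflp E"
  shows "(monomial m :: ('v, 'k::field) mpoly) \<in> edge_ideal E \<longleftrightarrow>
    (\<exists>a\<in>Poly_Mapping.keys m. \<exists>b\<in>Poly_Mapping.keys m. E a b)"
  by (simp add: in_edge_ideal_iff[OF assms] keys_monomial)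

lemma squarefree_edge_ideal:
  assumes "irreflp E"
  shows "squarefree_monomial_ideal (edge_ideal E)"
  unfolding squarefree_monomial_ideal_def edge_ideal_eq
  using assms
  by (intro exI[of _ "{Poly_Mapping.single a 1 + Poly_Mapping.single b 1 |a b. E a b}"])
     (auto simp: squarefree_monomial_def lookup_add lookup_single when_def irreflp_def)

text \<open>A divisor of this product has its support in \<open>{a, b}\<close>; to lie in the ideal
  it must contain two distinct ends of an edge, hence both \<open>a\<close> and
  \<open>b\<close>.\<close>

lemma edge_in_min_gens:
  assumes "irreflp E" "E a b"
  shows "Poly_Mapping.single a 1 + Poly_Mapping.single b 1 \<in>
    min_gens (edge_ideal E :: ('v, 'k::field) mpoly set)"
proof -
  let ?e = "Poly_Mapping.single a (1::nat) + Poly_Mapping.single b 1"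
  have ab: "a \<noteq> b" using assms by (auto simp: irreflp_def)
  have "m = ?e" if m: "(monomial m :: ('v, 'k) mpoly) \<in> edge_ideal E"
    and le: "\<And>v. Poly_Mapping.lookup m v \<le> Poly_Mapping.lookup ?e v" for m
  proof -
    obtain u v where uv: "u \<in> Poly_Mapping.keys m" "v \<in> Poly_Mapping.keys m" "E u v"
      using m assms(1) by (auto simp: monomial_in_edge_ideal_iff)
    have ends: "w \<in> {a, b}" if "w \<in> Poly_Mapping.keys m" for w
      using that le[of w] by (auto simp: in_keys_iff lookup_add lookup_single when_def split: if_splits)
    have "u \<noteq> v" using uv(3) assms(1) by (auto simp: irreflp_def)
    then have "a \<in> Poly_Mapping.keys m" "b \<in> Poly_Mapping.keys m"
      using ends[OF uv(1)] ends[OF uv(2)] uv by auto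
    then obtain n where n: "m = n + ?e"
      using two_keys_split ab by metis
    have "n = 0"
      using le by (intro poly_mapping_eqI) (simp add: n lookup_add)
    then show ?thesis using n by simp
  qed
  then show ?thesis
    using assms by (auto simp: min_gens_def monomial_in_edge_ideal_iff keys_add_nat)
qed

lemma edge_occurs_in_gens:
  assumes "irreflp E" "E a b"
  shows "occurs_in_gens a (edge_ideal E)"
  unfolding occurs_in_gens_def
  by (rule bexI[OF _ edge_in_min_gens[OF assms]]) (simp add: keys_add_nat)

section \<open>From bipartitions to polarizations\<close>

text \<open>The edges at the two copies of \<open>i\<close> are oriented away from them, as in the
  list of generators, so that \<open>bipartition_ideal\<close> is literally an edge ideal.\<close>

definition split_edge ::
  "('v \<Rightarrow> 'v \<Rightarrow> bool) \<Rightarrow> 'v \<Rightarrow> 'v set \<Rightarrow> 'v set \<Rightarrow> 'v option \<Rightarrow> 'v option \<Rightarrow> bool" where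
  "split_edge E i A B u v \<longleftrightarrow>
     (\<exists>a b. u = Some a \<and> v = Some b \<and> E a b \<and> a \<noteq> i \<and> b \<noteq> i) \<or>
     (u = Some i \<and> v \<in> Some ` A) \<or> (u = None \<and> v \<in> Some ` B)"

lemma bipartition_ideal_eq: "bipartition_ideal E i A B = edge_ideal (split_edge E i A B)"
  unfolding bipartition_ideal_def edge_ideal_def split_edge_def
  by (rule arg_cong[where f = ideal.span]) blast

lemma bipartition_ideal_is_polarization:
  fixes E :: "'v \<Rightarrow> 'v \<Rightarrow> bool"
  assumes sym: "symp E" and irr: "irreflp E" and AB: "complete_bipartition E (link E i) A B"
  shows "is_polarization E i (bipartition_ideal E i A B :: ('v option, 'k::field) mpoly set)"
proof -
  let ?E' = "split_edge E i A B" and ?f = "case_option i id :: 'v option \<Rightarrow> 'v"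
  let ?J = "edge_ideal ?E' :: ('v option, 'k) mpoly set"
  have link: "E i a \<longleftrightarrow> a \<in> A \<union> B" for a
    using AB by (auto simp: complete_bipartition_def link_def)
  have nonempty: "A \<noteq> {}" "B \<noteq> {}" and complete: "\<And>a b. a \<in> A \<Longrightarrow> b \<in> B \<Longrightarrow> E a b"
    using AB by (auto simp: complete_bipartition_def)
  have i: "i \<notin> A" "i \<notin> B"
    using link irr by (auto simp: irreflp_def)
  have irr': "irreflp ?E'"
    using irr i by (auto simp: irreflp_def split_edge_def)
  have nzd: "nonzerodivisor_mod (var (Some i) - var None) ?J"
  proof (subst nonzerodivisor_mod_var_diff_iff[OF squarefree_edge_ideal[OF irr']],
      simp, intro allI impI, elim conjE)
    fix m
    assume x: "(monomial (Poly_Mapping.single (Some i) 1 + m) :: ('v option, 'k) mpoly) \<in> ?J"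
      and y: "(monomial (Poly_Mapping.single None 1 + m) :: ('v option, 'k) mpoly) \<in> ?J"
    have "\<exists>u\<in>Poly_Mapping.keys m. \<exists>v\<in>Poly_Mapping.keys m. ?E' u v"
    proof (rule ccontr)
      \<comment> \<open>An edge in the support of \<open>x_i m\<close> must now use
        \<open>x_i\<close>, which gives a variable of \<open>m\<close> from \<open>A\<close>;
        likewise the new variable gives one from \<open>B\<close>. By completeness these two are
        adjacent.\<close>
      assume no: "\<not> ?thesis"
      obtain u v where uv: "u \<in> insert (Some i) (Poly_Mapping.keys m)"
          "v \<in> insert (Some i) (Poly_Mapping.keys m)" "?E' u v"
        using x unfolding monomial_in_edge_ideal_iff[OF irr'] by (auto simp: keys_add_nat)
      then have "u = Some i \<or> v = Some i" using no by blast
      then obtain a where a: "a \<in> A" "Some a \<in> Poly_Mapping.keys m"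
        using uv i by (auto simp: split_edge_def)
      obtain u v where uv: "u \<in> insert None (Poly_Mapping.keys m)"
          "v \<in> insert None (Poly_Mapping.keys m)" "?E' u v"
        using y unfolding monomial_in_edge_ideal_iff[OF irr'] by (auto simp: keys_add_nat)
      then have "u = None \<or> v = None" using no by blast
      then obtain b where b: "b \<in> B" "Some b \<in> Poly_Mapping.keys m"
        using uv by (auto simp: split_edge_def)
      have "?E' (Some a) (Some b)"
        using a b i complete by (auto simp: split_edge_def)
      then show False using no a b by blast
    qed
    then show "(monomial m :: ('v option, 'k) mpoly) \<in> ?J"
      by (simp add: monomial_in_edge_ideal_iff[OF irr'])
  qed
  have E'_E: "E (?f u) (?f v)" if "?E' u v" for u v
    using that link by (auto simp: split_edge_def)
  have lift: "\<exists>m'. push_forward ?f m' = m \<and>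
          (\<exists>u\<in>Poly_Mapping.keys m'. \<exists>v\<in>Poly_Mapping.keys m'. ?E' u v)"
    if ab: "a \<in> Poly_Mapping.keys m" "b \<in> Poly_Mapping.keys m" "E a b"
    for a b and m :: "'v \<Rightarrow>\<^sub>0 nat"
  proof -
    \<comment> \<open>Two ways to lift a monomial: \<open>Some\<close> keeps every power of
      \<open>x_i\<close>, \<open>?s\<close> moves all of them to the new variable. An edge from
      \<open>i\<close> to \<open>c\<close> lifts by the first if \<open>c\<close> is in
      \<open>A\<close>, by the second if \<open>c\<close> is in \<open>B\<close>.\<close>
    let ?s = "\<lambda>j. if j = i then None else Some j"
    have sections: "push_forward ?f (push_forward Some m) = m"
        "push_forward ?f (push_forward ?s m) = m"
      by (auto simp: push_forward_push_forward intro: push_forward_ident)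
    have "(\<exists>u\<in>Some ` Poly_Mapping.keys m. \<exists>v\<in>Some ` Poly_Mapping.keys m. ?E' u v) \<or>
        (\<exists>u\<in>?s ` Poly_Mapping.keys m. \<exists>v\<in>?s ` Poly_Mapping.keys m. ?E' u v)"
    proof (cases "a = i \<or> b = i")
      case False
      then have "?E' (Some a) (Some b)"
        using ab by (simp add: split_edge_def)
      then show ?thesis using ab by blast
    next
      case True
      then obtain c where c: "c \<in> Poly_Mapping.keys m" "i \<in> Poly_Mapping.keys m" "c \<in> A \<union> B"
        using ab link sympD[OF sym ab(3)] by auto
      then show ?thesis
      proof (cases "c \<in> A")
        case True
        then have "?E' (Some i) (Some c)" by (simp add: split_edge_def)
        then show ?thesis using c by blast
      next
        case False
        then have "?E' (?s i) (?s c)"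
          using c i by (auto simp: split_edge_def)
        then show ?thesis using c by blast
      qed
    qed
    then show ?thesis
      unfolding keys_push_forward_nat[symmetric] using sections by blast
  qed
  have "depolarize i ` ?J = edge_ideal E"
  proof
    show "depolarize i ` ?J \<subseteq> edge_ideal E"
      unfolding depolarize_eq_push_forward
    proof (intro image_subsetI,
        unfold in_edge_ideal_iff[OF irr] in_edge_ideal_iff[OF irr'], rule ballI)
      fix p :: "('v option, 'k) mpoly" and m
      assume p: "\<forall>m\<in>Poly_Mapping.keys p. \<exists>a\<in>Poly_Mapping.keys m. \<exists>b\<in>Poly_Mapping.keys m. ?E' a b"
        and "m \<in> Poly_Mapping.keys (push_forward (push_forward ?f) p)"
      then obtain m' where m': "m' \<in> Poly_Mapping.keys p" "m = push_forward ?f m'"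
        using keys_push_forward_subset[of "push_forward ?f" p] by blast
      obtain u v where uv: "u \<in> Poly_Mapping.keys m'" "v \<in> Poly_Mapping.keys m'" "?E' u v"
        using p m'(1) by blast
      show "\<exists>a\<in>Poly_Mapping.keys m. \<exists>b\<in>Poly_Mapping.keys m. E a b"
        unfolding m'(2) keys_push_forward_nat using E'_E[OF uv(3)] uv(1,2) by blast
    qed
  next
    show "edge_ideal E \<subseteq> depolarize i ` ?J"
    proof
      fix p :: "('v, 'k) mpoly" assume "p \<in> edge_ideal E"
      then have "\<forall>m\<in>Poly_Mapping.keys p. \<exists>m'. push_forward ?f m' = m \<and>
          (\<exists>u\<in>Poly_Mapping.keys m'. \<exists>v\<in>Poly_Mapping.keys m'. ?E' u v)"
        unfolding in_edge_ideal_iff[OF irr] using lift by blast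
      \<comment> \<open>Relabelling \<open>p\<close> along a choice \<open>g\<close> of lifts gives
        a preimage in the ideal, since merging after \<open>g\<close> is the identity on the keys of
        \<open>p\<close>.\<close>
      then obtain g where g: "\<And>m. m \<in> Poly_Mapping.keys p \<Longrightarrow> push_forward ?f (g m) = m"
          "\<And>m. m \<in> Poly_Mapping.keys p \<Longrightarrow> \<exists>u\<in>Poly_Mapping.keys (g m). \<exists>v\<in>Poly_Mapping.keys (g m). ?E' u v"
        unfolding bchoice_iff by blast
      have "depolarize i (push_forward g p) = p"
        unfolding depolarize_eq_push_forward push_forward_push_forward
        by (rule push_forward_ident) (rule g)
      moreover have "push_forward g p \<in> ?J"
        unfolding in_edge_ideal_iff[OF irr'] using keys_push_forward_subset[of g p] g(2) by blast
      ultimately show "p \<in> depolarize i ` ?J" by (metis imageI)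
    qed
  qed
  moreover have "occurs_in_gens (Some i) ?J" "occurs_in_gens None ?J"
    using nonempty edge_occurs_in_gens[OF irr', of "Some i"] edge_occurs_in_gens[OF irr', of None]
    by (auto simp: split_edge_def)
  ultimately show ?thesis
    unfolding is_polarization_def bipartition_ideal_eq
    using nzd squarefree_edge_ideal[OF irr'] by blast
qed

section \<open>From polarizations to bipartitions\<close>

lemma bipartition_of_polarization:
  fixes E :: "'v \<Rightarrow> 'v \<Rightarrow> bool" and J :: "('v option, 'k::field) mpoly set"
  assumes sym: "symp E" and irr: "irreflp E" and pol: "is_polarization E i J"
  shows "\<exists>A B. complete_bipartition E (link E i) A B"
proof -
  let ?f = "case_option i id :: 'v option \<Rightarrow> 'v"
  let ?in = "\<lambda>m. (monomial m :: ('v option, 'k) mpoly) \<in> J"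
  let ?s = "\<lambda>v. Poly_Mapping.single v (1::nat)"
  have sqf: "squarefree_monomial_ideal J" and image: "depolarize i ` J = edge_ideal E"
    and nzd: "nonzerodivisor_mod (var (Some i) - var None) J"
    and occurs: "occurs_in_gens (Some i) J" "occurs_in_gens None J"
    using pol by (auto simp: is_polarization_def)
  obtain M where J: "J = ideal.span (monomial ` M)"
    using sqf by (auto simp: squarefree_monomial_ideal_def)
  have in_add: "?in (n + m)" if "?in m" for m n
    using that unfolding J by (rule monomial_add_in_span)
  have in_cancel: "?in m" if "?in (?s (Some i) + m)" "?in (?s None + m)" for m
    using nzd that nonzerodivisor_mod_var_diff_iff[OF sqf, of "Some i" None] by blast
  have in_two: "?in m"
    if "?in (?s u + ?s v)" "u \<in> Poly_Mapping.keys m" "v \<in> Poly_Mapping.keys m" "u \<noteq> v" for u v m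
    using two_keys_split[OF that(2-4)] in_add[OF that(1)] by blast
  \<comment> \<open>Depolarization sends a monomial of \<open>J\<close> to a single monomial of the
    edge ideal, whose support contains an edge.\<close>
  have in_edge: "\<exists>u\<in>Poly_Mapping.keys m. \<exists>v\<in>Poly_Mapping.keys m. E (?f u) (?f v)"
    if "?in m" for m
  proof -
    have "depolarize i (monomial m :: ('v option, 'k) mpoly) \<in> edge_ideal E"
      using that image by blast
    then have "(monomial (push_forward ?f m) :: ('v, 'k) mpoly) \<in> edge_ideal E"
      by (simp add: depolarize_eq_push_forward monomial_def)
    then show ?thesis
      by (simp add: monomial_in_edge_ideal_iff[OF irr] keys_push_forward_nat)
  qed
  \<comment> \<open>Some term of a preimage of \<open>x_a x_b\<close> maps to this monomial. It lies
    in \<open>J\<close> because \<open>J\<close> is a monomial ideal, and it is again a product of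
    two variables.\<close>
  have edge_in: "\<exists>u v. ?f u = a \<and> ?f v = b \<and> ?in (?s u + ?s v)" if "E a b" for a b
  proof -
    have "a \<noteq> b" using that irr by (auto simp: irreflp_def)
    have "(monomial (?s a + ?s b) :: ('v, 'k) mpoly) \<in> edge_ideal E"
      using that by (auto simp: monomial_in_edge_ideal_iff[OF irr] keys_add_nat)
    then obtain p where p: "p \<in> J" "monomial (?s a + ?s b) = push_forward (push_forward ?f) p"
      unfolding image[symmetric] depolarize_eq_push_forward by blast
    have "?s a + ?s b \<in> Poly_Mapping.keys (push_forward (push_forward ?f) p)"
      unfolding p(2)[symmetric] by (simp add: keys_monomial)
    then obtain m where m: "m \<in> Poly_Mapping.keys p" "push_forward ?f m = ?s a + ?s b"
      using keys_push_forward_subset[of "push_forward ?f" p] by auto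
    have "?in m"
      using p(1) m(1) unfolding J by (subst (asm) in_monomial_ideal_iff_monomials) blast
    then show ?thesis
      using push_forward_eq_two_singles[OF m(2) \<open>a \<noteq> b\<close>] by metis
  qed
  have f_eq: "u = Some a" if "?f u = a" "a \<noteq> i" for u a
    using that by (cases u) auto
  have f_eq_i: "u = Some i \<or> u = None" if "?f u = i" for u
    using that by (cases u) auto
  have link_in: "?in (?s (Some i) + ?s (Some a)) \<or> ?in (?s None + ?s (Some a))" if "E i a" for a
  proof -
    have "a \<noteq> i" using that irr by (auto simp: irreflp_def)
    then show ?thesis
      using edge_in[OF that] f_eq f_eq_i by metis
  qed
  have in_link: "E i a" if "?in (?s u + ?s (Some a))" "?f u = i" for u a
    using in_edge[OF that(1)] that(2) irr sym
    by (auto simp: keys_add_nat irreflp_def dest: sympD)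
  \<comment> \<open>Let \<open>w\<close> be the other copy of \<open>i\<close> and \<open>m\<close>
    a minimal generator, the product of \<open>u\<close> and \<open>n\<close>. Then \<open>n\<close>
    is outside \<open>J\<close> by minimality, and so is its product with \<open>w\<close> by the
    criterion. The support of \<open>m\<close> lies over an edge. If this joins \<open>i\<close> to
    some \<open>a\<close>, then \<open>a\<close> occurs in \<open>n\<close>, and the product of
    \<open>w\<close> and \<open>x_a\<close> is in \<open>J\<close>, as that of \<open>u\<close> and
    \<open>x_a\<close> is not. If it avoids \<open>i\<close>, the product of its ends is in
    \<open>J\<close> and divides \<open>n\<close>. Both are impossible.\<close>
  have nonempty: "\<exists>a. ?in (?s u + ?s (Some a))"
    if uw: "u = Some i \<and> w = None \<or> u = None \<and> w = Some i" and occ: "occurs_in_gens u J" for u w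
  proof (rule ccontr)
    assume no: "\<nexists>a. ?in (?s u + ?s (Some a))"
    obtain m where m: "m \<in> min_gens J" "u \<in> Poly_Mapping.keys m"
      using occ by (auto simp: occurs_in_gens_def)
    define n where "n = m - ?s u"
    have mn: "m = ?s u + n"
      unfolding n_def using m(2) by (rule single_plus_minus)
    have in_m: "?in (?s u + n)"
      using m(1) by (simp add: min_gens_def mn)
    have not_n: "\<not> ?in n"
    proof
      assume "?in n"
      moreover have "\<forall>v. Poly_Mapping.lookup n v \<le> Poly_Mapping.lookup m v"
        by (simp add: mn lookup_add)
      ultimately have "n = m"
        using m(1) by (auto simp: min_gens_def)
      then have "Poly_Mapping.lookup n u = Poly_Mapping.lookup (?s u + n) u" using mn by simp
      then show False by (simp add: lookup_add)
    qed
    have not_w: "\<not> ?in (?s w + n)"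
      using in_m not_n in_cancel uw by blast
    have mem_n: "Some a \<in> Poly_Mapping.keys n"
      if "v \<in> Poly_Mapping.keys (?s u + n)" "?f v = a" "a \<noteq> i" for v a
      using that f_eq[OF that(2,3)] uw by (auto simp: keys_add_nat)
    have no_nbr: False if "E i a" "Some a \<in> Poly_Mapping.keys n" for a
    proof -
      have "?in (?s w + ?s (Some a))"
        using link_in[OF that(1)] no uw by blast
      moreover have "?s w + n = (n - ?s (Some a)) + (?s w + ?s (Some a))"
        using single_plus_minus[OF that(2)] by (metis add.assoc add.commute)
      ultimately show False
        using in_add not_w by metis
    qed
    obtain v v' where v: "v \<in> Poly_Mapping.keys (?s u + n)" "v' \<in> Poly_Mapping.keys (?s u + n)"
        "E (?f v) (?f v')"
      using in_edge[OF in_m] by blast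
    have ne: "?f v \<noteq> ?f v'"
      using v(3) irr by (auto simp: irreflp_def)
    consider "?f v = i" | "?f v' = i" | "?f v \<noteq> i" "?f v' \<noteq> i" by blast
    then show False
    proof cases
      case 1
      then show False using v ne mem_n[OF v(2) refl] no_nbr by metis
    next
      case 2
      then show False using v ne mem_n[OF v(1) refl] no_nbr sympD[OF sym] by metis
    next
      case 3
      have "?in (?s (Some (?f v)) + ?s (Some (?f v')))"
        using edge_in[OF v(3)] f_eq 3 by metis
      then show False
        using in_two mem_n[OF v(1) refl 3(1)] mem_n[OF v(2) refl 3(2)] ne not_n by blast
    qed
  qed
  define A where "A = {a. ?in (?s (Some i) + ?s (Some a))}"
  define B where "B = {a. ?in (?s None + ?s (Some a))}"
  have "A \<union> B = link E i"
    using link_in in_link by (auto simp: A_def B_def link_def)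
  moreover have "A \<inter> B = {}"
  proof (rule ccontr)
    assume "A \<inter> B \<noteq> {}"
    \<comment> \<open>Cancelling \<open>x_i\<close> and the new variable leaves the single variable
      \<open>x_a\<close> in \<open>J\<close>, whose support contains no edge.\<close>
    then obtain a where "?in (?s (Some a))"
      using in_cancel by (auto simp: A_def B_def)
    then show False
      using in_edge irr by (fastforce simp: irreflp_def)
  qed
  moreover have "A \<noteq> {}" "B \<noteq> {}"
    using nonempty[of "Some i" None] nonempty[of None "Some i"] occurs by (auto simp: A_def B_def)
  moreover have "E a b" if "a \<in> A" "b \<in> B" for a b
  proof -
    \<comment> \<open>Up to reordering these are the products of \<open>x_a x_b\<close> with
      \<open>x_i\<close> and with the new variable.\<close>
    have "?in (?s (Some b) + (?s (Some i) + ?s (Some a)))"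
        "?in (?s (Some a) + (?s None + ?s (Some b)))"
      using that by (simp_all only: A_def B_def mem_Collect_eq in_add)
    then have "?in (?s (Some a) + ?s (Some b))"
      by - (rule in_cancel, simp_all only: ac_simps)
    then show ?thesis
      using in_edge irr sym by (fastforce simp: keys_add_nat irreflp_def dest: sympD)
  qed
  ultimately have "complete_bipartition E (link E i) A B"
    by (simp add: complete_bipartition_def)
  then show ?thesis by blast
qed

theorem proposition4p13:
  fixes E :: "'v::finite \<Rightarrow> 'v \<Rightarrow> bool" and i :: 'v
  assumes "symp E" and "irreflp E"
  shows "((\<exists>J :: ('v option, 'k::field) mpoly set. is_polarization E i J) \<longleftrightarrow>
            (\<exists>A B. complete_bipartition E (link E i) A B)) \<and>
         (\<forall>A B. complete_bipartition E (link E i) A B \<longrightarrow>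
            is_polarization E i (bipartition_ideal E i A B :: ('v option, 'k) mpoly set))"
  using bipartition_of_polarization[OF assms] bipartition_ideal_is_polarization[OF assms] by blast

end
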